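(* Let $n, m$ be nonnegative integers, and let $f(k)$ denote the number of unlabeled topologies on $k$ points. Then: (i) $f(n+m) \geq f(n)\, f(m)$. (ii) If $n+m\ge 2$, then $f(n+m) \geq \max\{ f(i)\, f(m+n-i) : 1 \leq i \leq n+m-1 \}$.
   Context: For a nonnegative integer $k$ and a finite set $E$ with $|E|=k$, a topology on $E$ (a topology on $k$ points) is a collection $\tau$ of subsets of $E$ containing $\emptyset$ and $E$ and closed under (pairwise) union and intersection. Topologies $\tau_1$ on $E_1$ and $\tau_2$ on $E_2$ are homeomorphic if there is a bijection $\varphi: E_1 \to E_2$ such that $\varphi(X) \in \tau_2$ if and only if $X \in \tau_1$, for all $X \subseteq E_1$. The number $f(k)$ of unlabeled topologies on $k$ points is the number of homeomorphism classes of topologies on a set of cardinality $k$. *)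

theory Defs
  imports "HOL-Analysis.Analysis"
begin

definition topologies_on :: "'a set \<Rightarrow> 'a topology set" where
  "topologies_on E = {X. topspace X = E}"

definition homeo_rel :: "'a set \<Rightarrow> ('a topology \<times> 'a topology) set" where
  "homeo_rel E = {(X, Y). X \<in> topologies_on E \<and> Y \<in> topologies_on E \<and> X homeomorphic_space Y}"

definition homeo_classes :: "'a set \<Rightarrow> 'a topology set set" where
  "homeo_classes E = topologies_on E // homeo_rel E"

text \<open>The choice of the \<open>k\<close>-element set is immaterial, see \<open>card_homeo_classes\<close> below.\<close>

definition num_unlabeled_topologies :: "nat \<Rightarrow> nat" where
  "num_unlabeled_topologies k = card (homeo_classes {..<k})"

text \<open>
  On a finite set, the library's topologies (closed under arbitrary unions) are exactly the
  families containing the empty set and the whole set that are closed under pairwise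
  unions and intersections.
\<close>

lemma finite_topology_iff:
  assumes "finite E"
  shows "(\<exists>X \<in> topologies_on E. \<tau> = {U. openin X U}) \<longleftrightarrow>
    \<tau> \<subseteq> Pow E \<and> {} \<in> \<tau> \<and> E \<in> \<tau> \<and>
    (\<forall>U\<in>\<tau>. \<forall>V\<in>\<tau>. U \<union> V \<in> \<tau> \<and> U \<inter> V \<in> \<tau>)" (is "?L \<longleftrightarrow> ?R")
proof
  assume ?L
  then show ?R
    by (auto simp: topologies_on_def dest: openin_subset)
next
  assume R: ?R
  have Un: "\<Union>\<K> \<in> \<tau>" if "\<K> \<subseteq> \<tau>" for \<K>
  proof -
    have "finite \<K>"
      using that R assms by (meson finite_Pow_iff finite_subset)
    then show ?thesis
      using that by (induction \<K>) (use R in auto)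
  qed
  have "istopology (\<lambda>U. U \<in> \<tau>)"
    using R Un unfolding istopology_def by (auto simp: subset_iff)
  then have o: "openin (topology (\<lambda>U. U \<in> \<tau>)) U \<longleftrightarrow> U \<in> \<tau>" for U
    by (simp add: topology_inverse')
  have "topspace (topology (\<lambda>U. U \<in> \<tau>)) = E"
    unfolding topspace_def o using R by blast
  with o show ?L
    by (intro bexI[of _ "topology (\<lambda>U. U \<in> \<tau>)"]) (auto simp: topologies_on_def)
qed

lemma homeomorphic_space_iff_bij:
  "X homeomorphic_space Y \<longleftrightarrow>
    (\<exists>\<phi>. bij_betw \<phi> (topspace X) (topspace Y) \<and>
      (\<forall>U \<subseteq> topspace X. openin Y (\<phi> ` U) \<longleftrightarrow> openin X U))" (is "?L \<longleftrightarrow> ?R")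
proof
  assume ?L
  then obtain f where f: "homeomorphic_map X Y f"
    by (auto simp: homeomorphic_space)
  then have "bij_betw f (topspace X) (topspace Y)"
    by (simp add: bij_betw_def homeomorphic_imp_surjective_map homeomorphic_imp_injective_map)
  with f show ?R
    using homeomorphic_map_openness by blast
next
  assume ?R
  then obtain f where b: "bij_betw f (topspace X) (topspace Y)"
    and o: "\<And>U. U \<subseteq> topspace X \<Longrightarrow> openin Y (f ` U) \<longleftrightarrow> openin X U"
    by blast
  have im: "f ` topspace X = topspace Y" and inj: "inj_on f (topspace X)"
    using b by (auto simp: bij_betw_def)
  have "continuous_map X Y f"
    unfolding continuous_map_def
  proof (intro conjI allI impI)
    show "f \<in> topspace X \<rightarrow> topspace Y"
      using im by blast
    fix V assume V: "openin Y V"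
    have "f ` {x \<in> topspace X. f x \<in> V} = V"
      using im openin_subset[OF V] by auto
    with V show "openin X {x \<in> topspace X. f x \<in> V}"
      using o[of "{x \<in> topspace X. f x \<in> V}"] by auto
  qed
  moreover have "open_map X Y f"
    unfolding open_map_def using o openin_subset by blast
  ultimately have "homeomorphic_map X Y f"
    using im inj by (intro bijective_open_imp_homeomorphic_map)
  then show ?L
    by (rule homeomorphic_map_imp_homeomorphic_space)
qed

lemma equiv_homeo_rel: "equiv (topologies_on E) (homeo_rel E)"
proof (rule equivI)
  show "sym (homeo_rel E)"
    unfolding sym_def homeo_rel_def by (blast intro: homeomorphic_space_sym[THEN iffD1])
  show "trans (homeo_rel E)"
    unfolding trans_def homeo_rel_def by (blast intro: homeomorphic_space_trans)
qed (auto simp: refl_on_def homeo_rel_def)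

lemma finite_topologies_on:
  assumes "finite E"
  shows "finite (topologies_on E)"
proof (rule inj_on_finite)
  show "inj_on (\<lambda>X. {U. openin X U}) (topologies_on E)"
    by (auto simp: inj_on_def topology_eq)
  show "(\<lambda>X. {U. openin X U}) ` topologies_on E \<subseteq> Pow (Pow E)"
    using openin_subset by (fastforce simp: topologies_on_def)
  show "finite (Pow (Pow E))"
    using assms by simp
qed

lemma finite_homeo_classes: "finite E \<Longrightarrow> finite (homeo_classes E)"
  unfolding homeo_classes_def
  by (rule finite_quotient) (auto simp: finite_topologies_on homeo_rel_def)

lemma transport_topology:
  assumes "X \<in> topologies_on E" and g: "bij_betw g F E"
  obtains Y where "Y \<in> topologies_on F" "Y homeomorphic_space X"
proof
  let ?Y = "pullback_topology F g X"
  have X: "topspace X = E"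
    using assms by (simp add: topologies_on_def)
  have im: "g ` F = E" and inj: "inj_on g F"
    using g by (auto simp: bij_betw_def)
  have Y: "topspace ?Y = F"
    using im by (auto simp: topspace_pullback_topology X)
  then show "?Y \<in> topologies_on F"
    by (simp add: topologies_on_def)
  have "openin X (g ` U) \<longleftrightarrow> openin ?Y U" if U: "U \<subseteq> F" for U
  proof
    assume "openin X (g ` U)"
    moreover have "U = g -` (g ` U) \<inter> F"
      using U inj by (auto simp: inj_on_def)
    ultimately show "openin ?Y U"
      unfolding openin_pullback_topology by blast
  next
    assume "openin ?Y U"
    then obtain V where V: "openin X V" "U = g -` V \<inter> F"
      unfolding openin_pullback_topology by blast
    have "g ` U = V"
      using V(2) openin_subset[OF V(1)] im X by auto
    with V show "openin X (g ` U)"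
      by simp
  qed
  then show "?Y homeomorphic_space X"
    unfolding homeomorphic_space_iff_bij Y X using g by blast
qed

lemma card_homeo_classes_le:
  fixes E :: "'a set" and F :: "'b set"
  assumes "finite F" and g: "bij_betw g F E"
  shows "card (homeo_classes E) \<le> card (homeo_classes F)"
proof (rule card_inj_on_le)
  define h where "h c = {Y \<in> topologies_on F. \<exists>X\<in>c. Y homeomorphic_space X}"
    for c :: "'a topology set"
  have cls: "homeo_rel E `` {X} = {X' \<in> topologies_on E. X homeomorphic_space X'}"
    if "X \<in> topologies_on E" for X
    using that by (auto simp: homeo_rel_def)
  have clsF: "homeo_rel F `` {X} = {X' \<in> topologies_on F. X homeomorphic_space X'}"
    if "X \<in> topologies_on F" for X
    using that by (auto simp: homeo_rel_def)
  have h: "h (homeo_rel E `` {X}) = {Y \<in> topologies_on F. Y homeomorphic_space X}"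
    if "X \<in> topologies_on E" for X
    using that homeomorphic_space_refl[of X] unfolding h_def cls[OF that]
    by (blast intro: homeomorphic_space_trans homeomorphic_space_sym[THEN iffD1])
  show "finite (homeo_classes F)"
    by (rule finite_homeo_classes) fact
  show "h ` homeo_classes E \<subseteq> homeo_classes F"
  proof
    fix d assume "d \<in> h ` homeo_classes E"
    then obtain X where X: "X \<in> topologies_on E" "d = h (homeo_rel E `` {X})"
      by (auto simp: homeo_classes_def quotient_def)
    obtain Y where Y: "Y \<in> topologies_on F" "Y homeomorphic_space X"
      using transport_topology[OF X(1) g] .
    have XY: "X homeomorphic_space Y"
      using Y(2) homeomorphic_space_sym by blast
    have "W homeomorphic_space X \<longleftrightarrow> Y homeomorphic_space W" for W :: "'b topology"
      using homeomorphic_space_trans[OF _ XY, of W] homeomorphic_space_trans[OF _ Y(2), of W]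
        homeomorphic_space_sym[of W Y] by blast
    then have "d = homeo_rel F `` {Y}"
      unfolding X(2) h[OF X(1)] clsF[OF Y(1)] by simp
    with Y(1) show "d \<in> homeo_classes F"
      by (auto simp: homeo_classes_def quotient_def)
  qed
  show "inj_on h (homeo_classes E)"
  proof (rule inj_onI)
    fix c d assume "c \<in> homeo_classes E" "d \<in> homeo_classes E" and eq: "h c = h d"
    then obtain X X' where X: "X \<in> topologies_on E" "c = homeo_rel E `` {X}"
      and X': "X' \<in> topologies_on E" "d = homeo_rel E `` {X'}"
      by (auto simp: homeo_classes_def quotient_def)
    obtain Y where Y: "Y \<in> topologies_on F" "Y homeomorphic_space X"
      using transport_topology[OF X(1) g] .
    have "Y homeomorphic_space X'"
      using eq Y unfolding X(2) X'(2) h[OF X(1)] h[OF X'(1)] by blast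
    moreover have "X homeomorphic_space Y"
      using Y(2) homeomorphic_space_sym by blast
    ultimately have "X homeomorphic_space X'"
      by (rule homeomorphic_space_trans[rotated])
    then have "(X, X') \<in> homeo_rel E"
      using X(1) X'(1) by (simp add: homeo_rel_def)
    then show "c = d"
      unfolding X(2) X'(2) by (rule equiv_class_eq[OF equiv_homeo_rel])
  qed
qed

lemma card_homeo_classes:
  assumes "finite E"
  shows "card (homeo_classes E) = num_unlabeled_topologies (card E)"
proof -
  obtain g where g: "bij_betw g E {..<card E}"
    using assms finite_same_card_bij[of E "{..<card E}"] by auto
  then obtain g' where g': "bij_betw g' {..<card E} E"
    using bij_betw_inv by blast
  show ?thesis
    unfolding num_unlabeled_topologies_def
    by (intro antisym card_homeo_classes_le[OF _ g] card_homeo_classes_le[OF _ g'])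
       (use assms in auto)
qed

end

theory Submission
  imports Defs
begin

text \<open>
  Topologies \<open>X\<close> and \<open>Y\<close> on disjoint sets \<open>A\<close> and \<open>B\<close> can be stacked: in the ordinal sum, the
  open sets are those of \<open>Y\<close> together with the sets \<open>B \<union> V\<close> for \<open>V\<close> open in \<open>X\<close>. In terms of
  specialization preorders, one preorder is placed entirely on one side of the other.
  Supermultiplicativity follows once the summands can be recovered, up to homeomorphism, from
  the sum and the sizes of \<open>A\<close> and \<open>B\<close>; the second claim of the theorem is the
  first one for the splittings of \<open>n + m\<close> into \<open>i\<close> and the rest.

  The summands can be recovered because \<open>B\<close> is comparable under inclusion with every open set of the sum: a
  homeomorphism carries \<open>B\<close> to an open set of the same finite cardinality, and the only open set
  of that cardinality is the bottom layer of the other sum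
  (\<open>homeomorphic_map_ordinal_sum_image\<close>). So the homeomorphism matches the layers, and it
  restricts to homeomorphisms between the summands (\<open>ordinal_sum_homeomorphic_cancel\<close>). The
  disjoint union would not do here, since connected components could be exchanged between
  its two parts without any trace.
\<close>

definition ordinal_sum :: "'a topology \<Rightarrow> 'a topology \<Rightarrow> 'a topology" where
  "ordinal_sum X Y = topology (\<lambda>U. openin Y U \<or> (\<exists>V. openin X V \<and> U = topspace Y \<union> V))"

lemma openin_ordinal_sum:
  "openin (ordinal_sum X Y) U \<longleftrightarrow> openin Y U \<or> (\<exists>V. openin X V \<and> U = topspace Y \<union> V)"
proof -
  let ?P = "\<lambda>U. openin Y U \<or> (\<exists>V. openin X V \<and> U = topspace Y \<union> V)"
  have Int: "?P (S \<inter> T)" if "?P S" "?P T" for S T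
  proof -
    have Y: "U \<inter> (topspace Y \<union> V) = U" "(topspace Y \<union> V) \<inter> U = U" if "openin Y U" for U V
      using openin_subset[OF that] by auto
    have "(topspace Y \<union> V) \<inter> (topspace Y \<union> W) = topspace Y \<union> V \<inter> W" for V W
      by blast
    with that Y show ?thesis
      by (metis openin_Int)
  qed
  have Union: "?P (\<Union>\<K>)" if \<K>: "\<forall>K\<in>\<K>. ?P K" for \<K>
  proof (cases "\<forall>K\<in>\<K>. openin Y K")
    case True
    then show ?thesis by blast
  next
    case False
    \<comment> \<open>A member that is not open in \<open>Y\<close> contains \<open>topspace Y\<close>, so it absorbs the members that are.\<close>
    define \<V> where "\<V> = {V. openin X V \<and> topspace Y \<union> V \<in> \<K>}"
    have "\<Union>\<K> = topspace Y \<union> \<Union>\<V>"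
    proof
      show "\<Union>\<K> \<subseteq> topspace Y \<union> \<Union>\<V>"
        using \<K> openin_subset unfolding \<V>_def by blast
      show "topspace Y \<union> \<Union>\<V> \<subseteq> \<Union>\<K>"
        using \<K> False unfolding \<V>_def by blast
    qed
    moreover have "openin X (\<Union>\<V>)"
      by (auto simp: \<V>_def)
    ultimately show ?thesis by blast
  qed
  have "istopology ?P"
    unfolding istopology_def using Int Union by blast
  then show ?thesis
    by (simp add: ordinal_sum_def topology_inverse')
qed

lemma topspace_ordinal_sum [simp]: "topspace (ordinal_sum X Y) = topspace X \<union> topspace Y"
proof
  show "topspace (ordinal_sum X Y) \<subseteq> topspace X \<union> topspace Y"
    using openin_topspace[of "ordinal_sum X Y"] unfolding openin_ordinal_sum
    by (auto dest: openin_subset)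
  have "openin (ordinal_sum X Y) (topspace Y \<union> topspace X)"
    unfolding openin_ordinal_sum by blast
  then show "topspace X \<union> topspace Y \<subseteq> topspace (ordinal_sum X Y)"
    by (auto dest: openin_subset)
qed

lemma subtopology_ordinal_sum_right: "subtopology (ordinal_sum X Y) (topspace Y) = Y"
proof -
  have "openin (subtopology (ordinal_sum X Y) (topspace Y)) U \<longleftrightarrow> openin Y U" for U
  proof
    assume "openin (subtopology (ordinal_sum X Y) (topspace Y)) U"
    then obtain T where T: "openin (ordinal_sum X Y) T" "U = T \<inter> topspace Y"
      unfolding openin_subtopology by blast
    from T(1) consider "openin Y T" | "topspace Y \<subseteq> T"
      unfolding openin_ordinal_sum by blast
    then show "openin Y U"
      by cases (use T(2) in \<open>auto simp: Int_absorb1\<close>)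
  next
    assume U: "openin Y U"
    then have "U = U \<inter> topspace Y"
      using openin_subset by blast
    with U show "openin (subtopology (ordinal_sum X Y) (topspace Y)) U"
      unfolding openin_subtopology openin_ordinal_sum by blast
  qed
  then show ?thesis
    by (simp add: topology_eq)
qed

lemma subtopology_ordinal_sum_left:
  assumes "topspace X \<inter> topspace Y = {}"
  shows "subtopology (ordinal_sum X Y) (topspace X) = X"
proof -
  have trace: "(topspace Y \<union> V) \<inter> topspace X = V" if "openin X V" for V
    using openin_subset[OF that] assms by blast
  have "openin (subtopology (ordinal_sum X Y) (topspace X)) U \<longleftrightarrow> openin X U" for U
  proof
    assume "openin (subtopology (ordinal_sum X Y) (topspace X)) U"
    then obtain T where T: "openin (ordinal_sum X Y) T" "U = T \<inter> topspace X"
      unfolding openin_subtopology by blast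
    from T(1) consider "openin Y T" | V where "openin X V" "T = topspace Y \<union> V"
      unfolding openin_ordinal_sum by blast
    then show "openin X U"
    proof cases
      case 1
      then have "U = {}"
        using T(2) openin_subset assms by blast
      then show ?thesis by simp
    next
      case 2
      then show ?thesis
        using T(2) trace by simp
    qed
  next
    assume "openin X U"
    then show "openin (subtopology (ordinal_sum X Y) (topspace X)) U"
      using trace[of U] unfolding openin_subtopology openin_ordinal_sum by metis
  qed
  then show ?thesis
    by (simp add: topology_eq)
qed

text \<open>
  The open sets of the second sum are comparable under inclusion with \<open>topspace Y'\<close>, so only
  \<open>topspace Y'\<close> itself has its finite cardinality. Finiteness is essential: on infinite sets, a chain
  of open sets can be cut in many places.
\<close>

lemma homeomorphic_map_ordinal_sum_image:
  assumes f: "homeomorphic_map (ordinal_sum X Y) (ordinal_sum X' Y') f"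
    and fin: "finite (topspace Y)" "finite (topspace Y')"
    and card: "card (topspace Y) = card (topspace Y')"
  shows "f ` topspace Y = topspace Y'"
proof -
  have "inj_on f (topspace Y)"
    using homeomorphic_imp_injective_map[OF f] by (auto intro: inj_on_subset)
  then have card_image: "card (f ` topspace Y) = card (topspace Y')"
    by (simp add: card_image card)
  have "openin (ordinal_sum X Y) (topspace Y)"
    by (simp add: openin_ordinal_sum)
  then have "openin (ordinal_sum X' Y') (f ` topspace Y)"
    using homeomorphic_map_openness[OF f, of "topspace Y"] by simp
  then consider "f ` topspace Y \<subseteq> topspace Y'" | "topspace Y' \<subseteq> f ` topspace Y"
    unfolding openin_ordinal_sum by (blast dest: openin_subset)
  then show ?thesis
  proof cases
    case 1
    then show ?thesis
      using card_image fin(2) by (intro card_subset_eq)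
  next
    case 2
    then show ?thesis
      using card_image fin(1) card_subset_eq[of "f ` topspace Y" "topspace Y'"] by simp
  qed
qed

text \<open>
  A homeomorphism of the sums that matches the lower layers is injective, hence matches the
  complementary upper layers too; both summands are subspaces, so restriction finishes the proof.
\<close>

lemma ordinal_sum_homeomorphic_cancel:
  assumes homeo: "ordinal_sum X Y homeomorphic_space ordinal_sum X' Y'"
    and disj: "topspace X \<inter> topspace Y = {}" "topspace X' \<inter> topspace Y' = {}"
    and fin: "finite (topspace Y)" "finite (topspace Y')"
    and card: "card (topspace Y) = card (topspace Y')"
  shows "X homeomorphic_space X'" "Y homeomorphic_space Y'"
proof -
  obtain f where f: "homeomorphic_map (ordinal_sum X Y) (ordinal_sum X' Y') f"
    using homeo by (auto simp: homeomorphic_space)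
  have Y: "f ` topspace Y = topspace Y'"
    using homeomorphic_map_ordinal_sum_image[OF f fin card] .
  have inj: "inj_on f (topspace X \<union> topspace Y)"
    using homeomorphic_imp_injective_map[OF f] by simp
  have im: "f ` (topspace X \<union> topspace Y) = topspace X' \<union> topspace Y'"
    using homeomorphic_imp_surjective_map[OF f] by simp
  have "f ` topspace X = f ` ((topspace X \<union> topspace Y) - topspace Y)"
    using disj(1) by (simp add: Un_Diff Diff_triv)
  also have "\<dots> = (topspace X' \<union> topspace Y') - topspace Y'"
    using inj_on_image_set_diff[OF inj, of "topspace X \<union> topspace Y" "topspace Y"] im Y
    by simp
  also have "\<dots> = topspace X'"
    using disj(2) by (simp add: Un_Diff Diff_triv)
  finally have X: "f ` topspace X = topspace X'" .
  have "homeomorphic_map (subtopology (ordinal_sum X Y) (topspace X))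
      (subtopology (ordinal_sum X' Y') (topspace X')) f"
    by (rule homeomorphic_map_subtopologies[OF f]) (simp add: X Int_absorb1)
  then show "X homeomorphic_space X'"
    unfolding subtopology_ordinal_sum_left[OF disj(1)] subtopology_ordinal_sum_left[OF disj(2)]
    by (rule homeomorphic_map_imp_homeomorphic_space)
  have "homeomorphic_map (subtopology (ordinal_sum X Y) (topspace Y))
      (subtopology (ordinal_sum X' Y') (topspace Y')) f"
    by (rule homeomorphic_map_subtopologies[OF f]) (simp add: Y Int_absorb1)
  then show "Y homeomorphic_space Y'"
    unfolding subtopology_ordinal_sum_right by (rule homeomorphic_map_imp_homeomorphic_space)
qed

text \<open>
  By cancellation, sending a pair of classes to the class of the ordinal sum of chosen
  representatives is injective, for any choice of representatives.
\<close>

lemma card_homeo_classes_Un_ge: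
  assumes fin: "finite A" "finite B" and disj: "A \<inter> B = {}"
  shows "card (homeo_classes A) * card (homeo_classes B) \<le> card (homeo_classes (A \<union> B))"
proof -
  define rep where "rep E c = (SOME X. X \<in> topologies_on E \<and> c = homeo_rel E `` {X})"
    for E :: "'a set" and c
  have rep: "rep E c \<in> topologies_on E" "c = homeo_rel E `` {rep E c}"
    if "c \<in> homeo_classes E" for c and E :: "'a set"
  proof -
    have "\<exists>X. X \<in> topologies_on E \<and> c = homeo_rel E `` {X}"
      using that by (auto simp: homeo_classes_def quotient_def)
    from someI_ex[OF this] show "rep E c \<in> topologies_on E" "c = homeo_rel E `` {rep E c}"
      unfolding rep_def by blast+
  qed
  have topspace_rep: "topspace (rep E c) = E" if "c \<in> homeo_classes E" for c and E :: "'a set"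
    using rep(1)[OF that] by (simp add: topologies_on_def)
  have rep_inj: "c = d"
    if "c \<in> homeo_classes E" "d \<in> homeo_classes E" "rep E c homeomorphic_space rep E d"
    for c d and E :: "'a set"
  proof -
    have "(rep E c, rep E d) \<in> homeo_rel E"
      using that rep(1) by (simp add: homeo_rel_def)
    then have "homeo_rel E `` {rep E c} = homeo_rel E `` {rep E d}"
      by (rule equiv_class_eq[OF equiv_homeo_rel])
    then show ?thesis
      using rep(2)[OF that(1)] rep(2)[OF that(2)] by argo
  qed
  define h where "h = (\<lambda>(c, d). homeo_rel (A \<union> B) `` {ordinal_sum (rep A c) (rep B d)})"
  have sum: "ordinal_sum (rep A c) (rep B d) \<in> topologies_on (A \<union> B)"
    if "c \<in> homeo_classes A" "d \<in> homeo_classes B" for c d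
    using that by (simp add: topologies_on_def topspace_rep)
  have "inj_on h (homeo_classes A \<times> homeo_classes B)"
  proof (rule inj_onI, clarify)
    fix c d c' d'
    assume c: "c \<in> homeo_classes A" "c' \<in> homeo_classes A"
      and d: "d \<in> homeo_classes B" "d' \<in> homeo_classes B"
      and "h (c, d) = h (c', d')"
    then have "(ordinal_sum (rep A c) (rep B d), ordinal_sum (rep A c') (rep B d'))
        \<in> homeo_rel (A \<union> B)"
      by (simp add: h_def eq_equiv_class_iff[OF equiv_homeo_rel] sum)
    then have homeo: "ordinal_sum (rep A c) (rep B d) homeomorphic_space
        ordinal_sum (rep A c') (rep B d')"
      by (simp add: homeo_rel_def)
    have "rep A c homeomorphic_space rep A c'" "rep B d homeomorphic_space rep B d'"
      using ordinal_sum_homeomorphic_cancel[OF homeo] c d fin disj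
      by (simp_all add: topspace_rep)
    then show "c = c' \<and> d = d'"
      using c d rep_inj by blast
  qed
  moreover have "h ` (homeo_classes A \<times> homeo_classes B) \<subseteq> homeo_classes (A \<union> B)"
    using sum by (auto simp: h_def homeo_classes_def[of "A \<union> B"] intro: quotientI)
  moreover have "finite (homeo_classes (A \<union> B))"
    using fin by (simp add: finite_homeo_classes)
  ultimately have "card (homeo_classes A \<times> homeo_classes B) \<le> card (homeo_classes (A \<union> B))"
    by (rule card_inj_on_le)
  then show ?thesis
    by (simp add: card_cartesian_product)
qed

lemma num_unlabeled_topologies_add_ge:
  "num_unlabeled_topologies n * num_unlabeled_topologies m \<le> num_unlabeled_topologies (n + m)"
proof -
  have "card (homeo_classes {..<n}) * card (homeo_classes {n..<n+m})
      \<le> card (homeo_classes ({..<n} \<union> {n..<n+m}))"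
    by (rule card_homeo_classes_Un_ge) auto
  moreover have "{..<n} \<union> {n..<n+m} = {..<n+m}"
    by auto
  ultimately show ?thesis
    by (simp add: card_homeo_classes)
qed

theorem corollary3p3:
  fixes n m :: nat
  shows "num_unlabeled_topologies (n + m)
           \<ge> num_unlabeled_topologies n * num_unlabeled_topologies m
       \<and> (n + m \<ge> 2 \<longrightarrow>
           num_unlabeled_topologies (n + m)
             \<ge> Max {num_unlabeled_topologies i * num_unlabeled_topologies (m + n - i) | i.
                     1 \<le> i \<and> i \<le> n + m - 1})"
proof (intro conjI impI)
  show "num_unlabeled_topologies n * num_unlabeled_topologies m \<le> num_unlabeled_topologies (n + m)"
    by (rule num_unlabeled_topologies_add_ge)
next
  assume nm: "2 \<le> n + m"
  let ?S = "{num_unlabeled_topologies i * num_unlabeled_topologies (m + n - i) | i.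
              1 \<le> i \<and> i \<le> n + m - 1}"
  have S: "?S = (\<lambda>i. num_unlabeled_topologies i * num_unlabeled_topologies (m + n - i)) ` {1..n+m-1}"
    by auto
  show "Max ?S \<le> num_unlabeled_topologies (n + m)"
  proof (rule Max.boundedI)
    show "finite ?S"
      unfolding S by simp
    show "?S \<noteq> {}"
      unfolding S using nm by simp
    fix a assume "a \<in> ?S"
    then obtain i where i: "i \<le> n + m - 1"
      and a: "a = num_unlabeled_topologies i * num_unlabeled_topologies (m + n - i)"
      by blast
    have "i + (m + n - i) = n + m"
      using i by simp
    with a show "a \<le> num_unlabeled_topologies (n + m)"
      using num_unlabeled_topologies_add_ge[of i "m + n - i"] by simp
  qed
qed

end
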